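(* Let $X$ be a topological space and let $A$ be a nonempty convex subset of $\mathcal{C}_b(X)$. Then either $A_1)$ or $A_2)$ is true, where: $A_1)$ there exists $\Phi_0\in A$ such that $\sup_{x\in X}\Phi_0(x)<0$; $A_2)$ there exists $\nu\in\overline{\mathrm{conv}}^{w^*}\{\delta_x : x\in X\}$ such that $\langle \nu,\Phi\rangle\geq 0$ for all $\Phi\in A$. If, moreover, $X$ is a completely regular Hausdorff pseudocompact space and $A$ is uniformly bounded and relatively compact for the topology $\tau_p$ of pointwise convergence on $X$, then in $A_2)$ one obtains $\langle \nu,\Phi\rangle\geq 0$ for all $\Phi\in\overline{A}^{\tau_p}$.
   Context: $\mathcal{C}_b(X)$ is the Banach space of all real-valued bounded continuous functions on $X$ with the supremum norm $\|\cdot\|_\infty$. For $x\in X$, $\delta_x\in(\mathcal{C}_b(X))^*$ is the evaluation functional $\delta_x(\varphi)=\varphi(x)$. $\overline{\mathrm{conv}}^{w^*}\{\delta_x : x\in X\}$ is the weak$^*$-closed convex hull of $\{\delta_x : x\in X\}$ in the dual $(\mathcal{C}_b(X))^*$. $\tau_p$ is the topology on $\mathcal{C}_b(X)$ of pointwise convergence on $X$; relative compactness and the closure $\overline{A}^{\tau_p}$ are in $(\mathcal{C}_b(X),\tau_p)$. A topological space is pseudocompact if its image under every real-valued continuous function is bounded. *)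

theory Defs
  imports "HOL-Analysis.Analysis"
begin

definition bcontfun_eval :: "'a::topological_space \<Rightarrow> ('a \<Rightarrow>\<^sub>C real) \<Rightarrow>\<^sub>L real" where
  "bcontfun_eval x = Blinfun (\<lambda>\<phi>. apply_bcontfun \<phi> x)"

lemma bcontfun_eval_apply [simp]: "blinfun_apply (bcontfun_eval x) \<phi> = apply_bcontfun \<phi> x"
proof -
  have "bounded_linear (\<lambda>\<phi> :: 'a \<Rightarrow>\<^sub>C real. apply_bcontfun \<phi> x)"
    by (rule bounded_linear_intro[where K = 1]) (simp_all, metis norm_bounded real_norm_def)
  then show ?thesis
    by (simp add: bcontfun_eval_def bounded_linear_Blinfun_apply)
qed

(* On a space of operators with values in the scalar field, the strong operator topology
   is the topology of pointwise convergence on the domain, that is, the weak-star topology. *)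
abbreviation weak_star_topology :: "('v::real_normed_vector \<Rightarrow>\<^sub>L real) topology" where
  "weak_star_topology \<equiv> strong_operator_topology"

(* The Euclidean topology on a function type is the product topology. *)
definition bcontfun_pointwise_topology :: "('a::topological_space \<Rightarrow>\<^sub>C real) topology" where
  "bcontfun_pointwise_topology = pullback_topology UNIV apply_bcontfun euclidean"

definition relatively_compactin :: "'a topology \<Rightarrow> 'a set \<Rightarrow> bool" where
  "relatively_compactin T S \<longleftrightarrow> S \<subseteq> topspace T \<and> compactin T (T closure_of S)"

definition pseudocompact_space :: "'a topology \<Rightarrow> bool" where
  "pseudocompact_space X \<longleftrightarrow>
    (\<forall>f::'a \<Rightarrow> real. continuous_map X euclidean f \<longrightarrow> bounded (f ` topspace X))"

definition eval_hull :: "(('a::topological_space \<Rightarrow>\<^sub>C real) \<Rightarrow>\<^sub>L real) set" where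
  "eval_hull = weak_star_topology closure_of (convex hull (range bcontfun_eval))"

definition some_sup_negative :: "('a::topological_space \<Rightarrow>\<^sub>C real) set \<Rightarrow> bool" where
  "some_sup_negative A \<longleftrightarrow> (\<exists>\<Phi>\<^sub>0\<in>A. (SUP x. apply_bcontfun \<Phi>\<^sub>0 x) < 0)"

definition some_functional_nonneg_on :: "('a::topological_space \<Rightarrow>\<^sub>C real) set \<Rightarrow> bool" where
  "some_functional_nonneg_on B \<longleftrightarrow> (\<exists>\<nu>\<in>eval_hull. \<forall>\<Phi>\<in>B. blinfun_apply \<nu> \<Phi> \<ge> 0)"

end

theory Submission
  imports Defs
begin

text \<open>If no \<open>\<Phi> \<in> A\<close> has negative supremum, a minimax argument (separation in the plane and induction)
  shows that for any finite part of \<open>A\<close> and any \<open>\<epsilon> > 0\<close> some convex combination of point evaluations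
  is above \<open>-\<epsilon>\<close> on that part, and weak-star compactness yields \<open>\<nu>\<close>.

  For the second claim it suffices that every \<open>\<Phi>\<close> in the pointwise closure is dominated up to \<open>\<epsilon>\<close> by
  some \<open>\<psi> \<in> A\<close>, \<open>\<psi> \<le> \<Phi> + \<epsilon>\<close>, since \<open>\<nu>\<close> is a monotone functional of mass 1. A sequence in \<open>A\<close>
  converges pointwise to \<open>\<Phi>\<close>, and because bounded continuous functions on a pseudocompact space attain
  their suprema, Simons' inequality provides the convex combination \<open>\<psi>\<close> of its members.\<close>

section \<open>Functionals in the closed hull of the evaluations\<close>

text \<open>A line separating \<open>S\<close> from the open quadrant would have a normal with
  nonnegative entries, because the quadrant is unbounded in both directions. Scaled to sum 1, the
  normal is a weight \<open>t\<close> violating \<open>near\<close>.\<close>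

lemma convex_plane_meets_quadrant:
  fixes S :: "(real \<times> real) set"
  assumes "convex S" "\<epsilon> > 0"
    and near: "\<And>t. 0 \<le> t \<Longrightarrow> t \<le> 1 \<Longrightarrow> \<exists>s\<in>S. (1 - t) * fst s + t * snd s > - \<epsilon>"
  shows "\<exists>s\<in>S. fst s > - \<epsilon> \<and> snd s > - \<epsilon>"
proof (rule ccontr)
  define Q where "Q = {- \<epsilon><..} \<times> {- \<epsilon><..}"
  assume "\<not> ?thesis"
  then have disj: "S \<inter> Q = {}"
    by (auto simp: Q_def)
  have "convex Q"
    unfolding Q_def by (intro convex_Times) (auto simp: convex_real_interval)
  moreover have "S \<noteq> {}" using near[of 0] by auto
  moreover have "(0, 0) \<in> Q" using \<open>\<epsilon> > 0\<close> by (simp add: Q_def)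
  ultimately obtain a b where "a \<noteq> 0" and S: "\<forall>x\<in>S. a \<bullet> x \<le> b" and Q: "\<forall>x\<in>Q. a \<bullet> x \<ge> b"
    using separating_hyperplane_sets[of S Q] \<open>convex S\<close> disj by blast
  obtain p q where a: "a = (p, q)" by (cases a)
  have Q': "p * u + q * v \<ge> b" if "u > - \<epsilon>" "v > - \<epsilon>" for u v
    using Q that by (auto simp: Q_def a)
  have b0: "b \<le> 0" using Q'[of 0 0] \<open>\<epsilon> > 0\<close> by simp
  have nonneg: "p \<ge> 0" "q \<ge> 0"
  proof -
    show "p \<ge> 0"
    proof (rule ccontr)
      assume "\<not> p \<ge> 0"
      then have p: "p < 0" by simp
      \<comment> \<open>As \<open>b \<le> 0\<close>, this abscissa lies in the quadrant, yet
        \<open>p\<close> times it is \<open>b - 1 < b\<close>.\<close>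
      have "(b - 1) / p \<ge> 0" using b0 p by (intro divide_nonpos_nonpos) auto
      then have "p * ((b - 1) / p) + q * 0 \<ge> b" using \<open>\<epsilon> > 0\<close> by (intro Q') auto
      then show False using p by simp
    qed
    show "q \<ge> 0"
    proof (rule ccontr)
      assume "\<not> q \<ge> 0"
      then have q: "q < 0" by simp
      have "(b - 1) / q \<ge> 0" using b0 q by (intro divide_nonpos_nonpos) auto
      then have "p * 0 + q * ((b - 1) / q) \<ge> b" using \<open>\<epsilon> > 0\<close> by (intro Q') auto
      then show False using q by simp
    qed
  qed
  have pq: "p + q > 0" using nonneg \<open>a \<noteq> 0\<close> by (auto simp: a zero_prod_def)
  have b: "b \<le> - \<epsilon> * (p + q)"
  proof (rule field_le_epsilon)
    fix e :: real assume "e > 0"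
    \<comment> \<open>The points \<open>(d - \<epsilon>, d - \<epsilon>)\<close> approach the corner
      of the quadrant, where the separating form has its infimum.\<close>
    define d where "d = e / (p + q)"
    have "d > 0" using \<open>e > 0\<close> pq by (simp add: d_def)
    then have "b \<le> p * (d - \<epsilon>) + q * (d - \<epsilon>)" by (intro Q') auto
    also have "\<dots> = - \<epsilon> * (p + q) + d * (p + q)" by (simp add: algebra_simps)
    also have "d * (p + q) = e" using pq by (simp add: d_def)
    finally show "b \<le> - \<epsilon> * (p + q) + e" .
  qed
  define t where "t = q / (p + q)"
  have t: "0 \<le> t" "t \<le> 1" "1 - t = p / (p + q)"
    using nonneg pq by (auto simp: t_def field_simps)
  then obtain s where s: "s \<in> S" "(1 - t) * fst s + t * snd s > - \<epsilon>"
    using near by blast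
  have "(1 - t) * fst s + t * snd s = (p * fst s + q * snd s) / (p + q)"
    by (simp only: t(3)) (simp add: t_def add_divide_distrib)
  also have "\<dots> \<le> b / (p + q)"
    using S s(1) pq by (intro divide_right_mono) (auto simp: a inner_prod_def)
  also have "\<dots> \<le> - \<epsilon>" using b pq by (simp add: field_simps)
  finally show False using s(2) by simp
qed

text \<open>Prescribing \<open>\<psi>\<close> shrinks \<open>C\<close> to \<open>C'\<close>, so
  \<open>C\<close> varies in the induction. \<open>C'\<close> inherits the hypothesis for every
  \<open>\<phi>\<close> by the planar lemma for the pairs \<open>(B c \<phi>, B c \<psi>)\<close>: a
  weight \<open>t\<close> there amounts to testing a convex combination of \<open>\<phi>\<close> and
  \<open>\<psi>\<close>, which stays in \<open>A\<close>.\<close>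

lemma bilinear_finite_minimax:
  fixes B :: "'v::real_vector \<Rightarrow> 'w::real_vector \<Rightarrow> real"
  assumes B: "bilinear B" and "convex A" "finite F" "F \<subseteq> A" "\<epsilon> > 0"
    and "convex C" "\<And>\<phi> \<delta>. \<phi> \<in> A \<Longrightarrow> \<delta> > 0 \<Longrightarrow> \<exists>c\<in>C. B c \<phi> > - \<delta>"
    and "C \<noteq> {}"
  shows "\<exists>c\<in>C. \<forall>\<phi>\<in>F. B c \<phi> > - \<epsilon>"
  using \<open>finite F\<close> \<open>F \<subseteq> A\<close> assms(6-)
proof (induction F arbitrary: C rule: finite_induct)
  case empty
  then show ?case by auto
next
  case (insert \<psi> F)
  have lin: "linear (\<lambda>c. B c \<phi>)" "linear (B c)" for c \<phi>
    using B by (auto simp: bilinear_def)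
  define C' where "C' = {c \<in> C. B c \<psi> > - \<epsilon>}"
  have "C' = C \<inter> (\<lambda>c. B c \<psi>) -` {- \<epsilon><..}" by (auto simp: C'_def)
  then have "convex C'"
    using insert.prems(2) lin by (auto intro!: convex_Int convex_linear_vimage simp: convex_real_interval)
  moreover have "\<exists>c\<in>C'. B c \<phi> > - \<delta>" if "\<phi> \<in> A" "\<delta> > 0" for \<phi> \<delta>
  proof -
    define S where "S = (\<lambda>c. (B c \<phi>, B c \<psi>)) ` C"
    have "linear (\<lambda>c. (B c \<phi>, B c \<psi>))"
      using B by (intro linearI) (auto simp: bilinear_ladd bilinear_lmul)
    then have "convex S"
      unfolding S_def using insert.prems(2) by (rule convex_linear_image)
    \<comment> \<open>One threshold serves two needs: above \<open>-\<delta>\<close> for the claim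
      on \<open>\<phi>\<close>, above \<open>-\<epsilon>\<close> for membership in
      \<open>C'\<close>.\<close>
    have "\<exists>s\<in>S. fst s > - min \<delta> \<epsilon> \<and> snd s > - min \<delta> \<epsilon>"
    proof (rule convex_plane_meets_quadrant)
      fix t :: real assume t: "0 \<le> t" "t \<le> 1"
      have "(1 - t) *\<^sub>R \<phi> + t *\<^sub>R \<psi> \<in> A"
        using \<open>convex A\<close> that insert.prems(1) t by (auto simp: convex_alt)
      then obtain c where "c \<in> C" "B c ((1 - t) *\<^sub>R \<phi> + t *\<^sub>R \<psi>) > - min \<delta> \<epsilon>"
        using insert.prems(3)[of _ "min \<delta> \<epsilon>"] \<open>\<delta> > 0\<close> \<open>\<epsilon> > 0\<close> by auto
      then show "\<exists>s\<in>S. (1 - t) * fst s + t * snd s > - min \<delta> \<epsilon>"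
        using B by (auto simp: S_def bilinear_radd bilinear_rmul)
    qed (use \<open>convex S\<close> \<open>\<delta> > 0\<close> \<open>\<epsilon> > 0\<close> in auto)
    then show ?thesis by (auto simp: S_def C'_def)
  qed
  moreover from this have "C' \<noteq> {}" using insert.prems(1) by (meson empty_iff equals0I insertCI subsetD zero_less_one)
  ultimately have "\<exists>c\<in>C'. \<forall>\<phi>\<in>F. B c \<phi> > - \<epsilon>"
    using insert.prems(1) by (intro insert.IH) auto
  then show ?case by (auto simp: C'_def)
qed

section \<open>Closures in function spaces and the compact hull of evaluations\<close>

text \<open>The weak-star and the pointwise topology are both pullbacks of the product topology on
  functions, so closures in either reduce to \<open>closure\<close> there.\<close>

lemma in_closure_of_pullback_iff:
  "x \<in> pullback_topology UNIV f euclidean closure_of S \<longleftrightarrow> f x \<in> closure (f ` S)"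
proof
  assume L: "x \<in> pullback_topology UNIV f euclidean closure_of S"
  show "f x \<in> closure (f ` S)"
    unfolding closure_iff_nhds_not_empty
  proof safe
    fix V W assume "V \<subseteq> W" "open V" "f x \<in> V" "f ` S \<inter> W = {}"
    moreover have "openin (pullback_topology UNIV f euclidean) (f -` V)"
      using \<open>open V\<close> by (auto simp: openin_pullback_topology)
    ultimately obtain s where "s \<in> S" "s \<in> f -` V"
      using L by (auto simp: in_closure_of)
    then show False using \<open>V \<subseteq> W\<close> \<open>f ` S \<inter> W = {}\<close> by auto
  qed
next
  assume R: "f x \<in> closure (f ` S)"
  show "x \<in> pullback_topology UNIV f euclidean closure_of S"
    unfolding in_closure_of
  proof safe
    show "x \<in> topspace (pullback_topology UNIV f euclidean)" by (simp add: topspace_pullback_topology)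
  next
    fix T assume "x \<in> T" "openin (pullback_topology UNIV f euclidean) T"
    then obtain V where "open V" "T = f -` V" by (auto simp: openin_pullback_topology)
    then show "\<exists>y. y \<in> S \<and> y \<in> T"
      using R \<open>x \<in> T\<close> unfolding closure_iff_nhds_not_empty by blast
  qed
qed

lemma closure_witness:
  fixes u :: "'i \<Rightarrow> real"
  assumes "u \<in> closure S" "finite D" "\<epsilon> > 0"
  shows "\<exists>v\<in>S. \<forall>d\<in>D. \<bar>v d - u d\<bar> < \<epsilon>"
proof -
  have "{v. \<forall>d\<in>D. \<bar>v d - u d\<bar> < \<epsilon>} = (\<Inter>d\<in>D. {v. \<bar>v d - u d\<bar> < \<epsilon>})" by auto
  moreover have "open {v :: 'i \<Rightarrow> real. \<bar>v d - u d\<bar> < \<epsilon>}" for d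
    by (intro open_Collect_less continuous_intros) auto
  ultimately have "open {v. \<forall>d\<in>D. \<bar>v d - u d\<bar> < \<epsilon>}"
    using \<open>finite D\<close> by (metis (no_types, lifting) open_INT)
  moreover have "u \<in> {v. \<forall>d\<in>D. \<bar>v d - u d\<bar> < \<epsilon>}" using \<open>\<epsilon> > 0\<close> by simp
  ultimately show ?thesis
    using assms(1) unfolding closure_iff_nhds_not_empty by (smt (verit) disjoint_iff mem_Collect_eq order_refl)
qed

text \<open>Carries linearity, bounds and equalities over to limits. In each use below the condition
  involves finitely many coordinates, hence is closed in the product topology.\<close>

lemma closure_subset_closed_property:
  assumes "u \<in> closure S" "closed {v. P v}" "\<And>v. v \<in> S \<Longrightarrow> P v"
  shows "P u"
  using closure_minimal[of S "{v. P v}"] assms by auto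

lemma bdd_above_bcontfun: "bdd_above (range (apply_bcontfun (\<phi> :: 'a::topological_space \<Rightarrow>\<^sub>C real)))"
  by (rule bdd_aboveI2[where M = "norm \<phi>"]) (metis norm_bounded real_norm_def abs_le_D1)

lemma eval_hull_iff:
  "\<nu> \<in> eval_hull \<longleftrightarrow> blinfun_apply \<nu> \<in> closure (blinfun_apply ` (convex hull (range bcontfun_eval)))"
  by (simp add: eval_hull_def strong_operator_topology_def in_closure_of_pullback_iff)

lemma hull_le:
  assumes "c \<in> convex hull (range bcontfun_eval)" "\<And>x. apply_bcontfun \<phi> x \<le> b"
  shows "blinfun_apply c \<phi> \<le> b"
proof -
  have "linear (\<lambda>c. blinfun_apply c \<phi>)"
    by (intro linearI) (auto simp: blinfun.add_left blinfun.scaleR_left)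
  then have "convex ((\<lambda>c. blinfun_apply c \<phi>) -` {..b})"
    by (intro convex_linear_vimage) (auto simp: convex_real_interval)
  then have "convex hull (range bcontfun_eval) \<subseteq> (\<lambda>c. blinfun_apply c \<phi>) -` {..b}"
    using assms(2) by (intro hull_minimal) auto
  then show ?thesis using assms(1) by auto
qed

text \<open>For a difference \<open>\<psi> - \<Phi>\<close> and \<open>b = \<epsilon>\<close> this
  expresses that \<open>\<nu>\<close> is monotone of mass 1.\<close>

lemma eval_hull_le:
  assumes "\<nu> \<in> eval_hull" "\<And>x. apply_bcontfun \<phi> x \<le> b"
  shows "blinfun_apply \<nu> \<phi> \<le> b"
proof (rule closure_subset_closed_property[where P = "\<lambda>v. v \<phi> \<le> b"])
  show "blinfun_apply \<nu> \<in> closure (blinfun_apply ` (convex hull (range bcontfun_eval)))"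
    using assms(1) by (simp add: eval_hull_iff)
  show "closed {v :: ('a \<Rightarrow>\<^sub>C real) \<Rightarrow> real. v \<phi> \<le> b}"
    by (intro closed_Collect_le continuous_intros) auto
qed (use assms(2) in \<open>auto intro: hull_le\<close>)

lemma hull_abs_le:
  assumes "c \<in> convex hull (range bcontfun_eval)"
  shows "\<bar>blinfun_apply c \<phi>\<bar> \<le> norm \<phi>"
proof -
  have "\<bar>apply_bcontfun \<phi> x\<bar> \<le> norm \<phi>" for x
    using norm_bounded[of \<phi> x] by simp
  then have "blinfun_apply c \<phi> \<le> norm \<phi>" "blinfun_apply c (- \<phi>) \<le> norm \<phi>"
    by (intro hull_le[OF assms]; simp add: abs_le_iff)+
  then show ?thesis by (simp add: blinfun.minus_right abs_le_iff)
qed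

text \<open>Tychonoff's theorem in the space of all real functions on the Banach space replaces the
  Banach--Alaoglu theorem: limits of the hull are automatically linear and bounded.\<close>

lemma compact_hull_closure:
  "compact (closure (blinfun_apply ` (convex hull (range (bcontfun_eval :: 'a::topological_space \<Rightarrow> _)))))"
    (is "compact (closure ?S)")
proof -
  let ?B = "PiE UNIV (\<lambda>\<phi> :: 'a \<Rightarrow>\<^sub>C real. {- norm \<phi>..norm \<phi>})"
  have "compactin (product_topology (\<lambda>_. euclidean) UNIV) ?B"
    by (subst compactin_PiE) auto
  then have "compact ?B"
    by (simp add: euclidean_product_topology)
  moreover have "closed ?B"
  proof -
    have "?B = {u. \<forall>\<phi>. - norm \<phi> \<le> u \<phi> \<and> u \<phi> \<le> norm \<phi>}" by (auto simp: PiE_def)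
    then show ?thesis
      by (auto intro!: closed_Collect_all closed_Collect_conj closed_Collect_le continuous_intros)
  qed
  moreover have "?S \<subseteq> ?B"
    using hull_abs_le by (auto simp: abs_le_iff minus_le_iff)
  ultimately show ?thesis
    using compact_Int_closed[of ?B "closure ?S"] closure_minimal[of ?S ?B] \<open>closed ?B\<close>
    by (simp add: Int_absorb1)
qed

lemma eval_hull_obtain:
  assumes "u \<in> closure (blinfun_apply ` (convex hull (range bcontfun_eval)))"
  obtains \<nu> where "\<nu> \<in> eval_hull" "blinfun_apply \<nu> = u"
proof -
  note cl = closure_subset_closed_property[OF assms]
  have "bounded_linear u"
  proof (rule bounded_linear_intro[where K = 1])
    fix \<phi> \<psi> and r :: real
    show "u (\<phi> + \<psi>) = u \<phi> + u \<psi>"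
      by (rule cl[where P = "\<lambda>u. u (\<phi> + \<psi>) = u \<phi> + u \<psi>"])
        (auto intro!: closed_Collect_eq continuous_intros simp: blinfun.add_right)
    show "u (r *\<^sub>R \<phi>) = r *\<^sub>R u \<phi>"
      by (rule cl[where P = "\<lambda>u. u (r *\<^sub>R \<phi>) = r *\<^sub>R u \<phi>"])
        (auto intro!: closed_Collect_eq continuous_intros simp: blinfun.scaleR_right)
    show "norm (u \<phi>) \<le> norm \<phi> * 1"
      by (rule cl[where P = "\<lambda>u. norm (u \<phi>) \<le> norm \<phi> * 1"])
        (auto intro!: closed_Collect_le continuous_intros hull_abs_le)
  qed
  then have "blinfun_apply (Blinfun u) = u" by (rule bounded_linear_Blinfun_apply)
  then show ?thesis using assms that[of "Blinfun u"] by (simp add: eval_hull_iff)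
qed

text \<open>The conditions on \<open>\<nu>\<close> are closed sets in a compact space, and the
  finite minimax lemma gives them the finite intersection property.\<close>

lemma some_functional_nonneg_onI:
  fixes A :: "('a::topological_space \<Rightarrow>\<^sub>C real) set"
  assumes "convex A" and sup: "\<And>\<phi>. \<phi> \<in> A \<Longrightarrow> (SUP x. apply_bcontfun \<phi> x) \<ge> 0"
  shows "some_functional_nonneg_on A"
proof -
  let ?C = "convex hull (range (bcontfun_eval :: 'a \<Rightarrow> _))"
  let ?K = "closure (blinfun_apply ` ?C)"
  \<comment> \<open>The slack is needed because a supremum \<open>\<ge> 0\<close> may only be
    approached from below by point evaluations.\<close>
  define Z where "Z = (\<lambda>(\<phi>, n). {u :: ('a \<Rightarrow>\<^sub>C real) \<Rightarrow> real. u \<phi> \<ge> - inverse (of_nat (Suc n))})"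
  have "?K \<inter> (\<Inter>i\<in>A \<times> UNIV. Z i) \<noteq> {}"
  proof (rule compact_imp_fip_image[OF compact_hull_closure])
    show "closed (Z i)" for i
      by (cases i) (auto simp: Z_def intro!: closed_Collect_le continuous_intros)
  next
    fix I' assume "finite I'" "I' \<subseteq> A \<times> (UNIV :: nat set)"
    \<comment> \<open>The strictest of the finitely many slacks, so that one application of the
      minimax lemma serves all of them.\<close>
    define N where "N = Max (snd ` I')"
    have N: "n \<le> N" if "(\<phi>, n) \<in> I'" for \<phi> n
      unfolding N_def using that \<open>finite I'\<close> by (intro Max_ge) force+
    have "\<exists>c\<in>?C. \<forall>\<phi>\<in>fst ` I'. blinfun_apply c \<phi> > - inverse (of_nat (Suc N))"
    proof (rule bilinear_finite_minimax[OF _ \<open>convex A\<close>])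
      show "bilinear (blinfun_apply :: (('a \<Rightarrow>\<^sub>C real) \<Rightarrow>\<^sub>L real) \<Rightarrow> _)"
        unfolding bilinear_def
        by (auto intro!: linearI simp: blinfun.add_left blinfun.add_right blinfun.scaleR_left blinfun.scaleR_right)
      show "\<exists>c\<in>?C. blinfun_apply c \<phi> > - \<delta>" if "\<phi> \<in> A" "\<delta> > 0" for \<phi> \<delta>
      proof -
        have "- \<delta> < (SUP x. apply_bcontfun \<phi> x)" using sup[OF that(1)] that(2) by simp
        then obtain x where "- \<delta> < apply_bcontfun \<phi> x"
          using less_cSUP_iff[OF _ bdd_above_bcontfun] by blast
        then show ?thesis
          by (intro bexI[of _ "bcontfun_eval x"]) (auto intro: hull_inc)
      qed
    qed (use \<open>finite I'\<close> \<open>I' \<subseteq> _\<close> in auto)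
    then obtain c where c: "c \<in> ?C" "\<forall>\<phi>\<in>fst ` I'. blinfun_apply c \<phi> > - inverse (of_nat (Suc N))" by blast
    have "blinfun_apply c \<in> Z i" if "i \<in> I'" for i
    proof -
      obtain \<phi> n where i: "i = (\<phi>, n)" by (cases i)
      have "inverse (real (Suc N)) \<le> inverse (real (Suc n))"
        using N that i by (intro le_imp_inverse_le) auto
      moreover have "blinfun_apply c \<phi> > - inverse (real (Suc N))"
        using c(2) that by (force simp: i)
      ultimately have "- inverse (real (Suc n)) \<le> blinfun_apply c \<phi>" by linarith
      then show ?thesis by (simp add: Z_def i)
    qed
    moreover have "blinfun_apply c \<in> ?K"
      by (rule subsetD[OF closure_subset imageI[OF c(1)]])
    ultimately show "?K \<inter> (\<Inter>i\<in>I'. Z i) \<noteq> {}" by blast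
  qed
  then obtain u where u: "u \<in> ?K" "\<And>\<phi> n. \<phi> \<in> A \<Longrightarrow> u \<phi> \<ge> - inverse (of_nat (Suc n))"
    by (auto simp: Z_def)
  obtain \<nu> where \<nu>: "\<nu> \<in> eval_hull" "blinfun_apply \<nu> = u" using eval_hull_obtain[OF u(1)] .
  have "blinfun_apply \<nu> \<phi> \<ge> 0" if "\<phi> \<in> A" for \<phi>
  proof (rule ccontr)
    assume "\<not> ?thesis"
    then obtain n where "inverse (of_nat (Suc n)) < - u \<phi>"
      using reals_Archimedean[of "- u \<phi>"] \<nu>(2) by auto
    then show False using u(2)[OF that, of n] by simp
  qed
  then show ?thesis using \<nu>(1) by (auto simp: some_functional_nonneg_on_def)
qed

text \<open>A functional in the hull is at most the supremum, so the alternatives exclude each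
  other. \<open>B\<close> is free in order to cover both \<open>A\<close> and its pointwise
  closure.\<close>

lemma some_sup_negative_imp_not_nonneg:
  assumes "some_sup_negative A" "A \<subseteq> B"
  shows "\<not> some_functional_nonneg_on B"
proof
  assume "some_functional_nonneg_on B"
  then obtain \<nu> where \<nu>: "\<nu> \<in> eval_hull" "\<forall>\<Phi>\<in>B. blinfun_apply \<nu> \<Phi> \<ge> 0"
    by (auto simp: some_functional_nonneg_on_def)
  obtain \<Phi> where \<Phi>: "\<Phi> \<in> A" "(SUP x. apply_bcontfun \<Phi> x) < 0"
    using assms(1) by (auto simp: some_sup_negative_def)
  have "blinfun_apply \<nu> \<Phi> \<le> (SUP x. apply_bcontfun \<Phi> x)"
    by (intro eval_hull_le \<nu> cSUP_upper bdd_above_bcontfun) auto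
  then show False using \<nu>(2) \<Phi> assms(2) by force
qed

section \<open>Pseudocompact spaces and Simons' inequality\<close>

text \<open>Without a zero, \<open>1 / F\<close> would be continuous, hence bounded, and
  \<open>F\<close> would stay away from 0.\<close>

lemma pseudocompact_has_zero:
  fixes F :: "'a::topological_space \<Rightarrow> real"
  assumes "pseudocompact_space (euclidean :: 'a topology)" "continuous_on UNIV F"
    and small: "\<And>\<epsilon>. \<epsilon> > 0 \<Longrightarrow> \<exists>y. \<bar>F y\<bar> < \<epsilon>"
  shows "\<exists>y. F y = 0"
proof (rule ccontr)
  assume "\<not> ?thesis"
  then have nz: "F y \<noteq> 0" for y by auto
  then have "continuous_on UNIV (\<lambda>y. inverse (F y))"
    using assms(2) by (intro continuous_intros) auto
  then have "bounded (range (\<lambda>y. inverse (F y)))"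
    using assms(1) by (auto simp: pseudocompact_space_def)
  then obtain K where K: "K > 0" "\<And>y. \<bar>inverse (F y)\<bar> \<le> K"
    unfolding bounded_pos by auto
  obtain y where "\<bar>F y\<bar> < inverse K" using small[of "inverse K"] K(1) by auto
  moreover have "inverse K \<le> \<bar>F y\<bar>"
    using le_imp_inverse_le[OF K(2)[of y]] nz[of y] by simp
  ultimately show False by simp
qed

text \<open>The gap between the supremum and \<open>h\<close> takes arbitrarily small values, so it
  has a zero.\<close>

lemma pseudocompact_attains_sup:
  fixes h :: "'a::topological_space \<Rightarrow>\<^sub>C real"
  assumes "pseudocompact_space (euclidean :: 'a topology)"
  obtains b where "\<And>x. apply_bcontfun h x \<le> apply_bcontfun h b"
proof -
  define s where "s = (SUP x. apply_bcontfun h x)"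
  have le: "apply_bcontfun h x \<le> s" for x
    unfolding s_def by (intro cSUP_upper bdd_above_bcontfun) auto
  have "\<exists>b. s - apply_bcontfun h b = 0"
  proof (rule pseudocompact_has_zero[OF assms])
    show "continuous_on UNIV (\<lambda>x. s - apply_bcontfun h x)" by (intro continuous_intros) auto
    fix \<epsilon> :: real assume "\<epsilon> > 0"
    then have "s - \<epsilon> < (SUP x. apply_bcontfun h x)" by (simp add: s_def)
    then obtain x where "s - \<epsilon> < apply_bcontfun h x" using less_cSUP_iff[OF _ bdd_above_bcontfun] by blast
    then show "\<exists>y. \<bar>s - apply_bcontfun h y\<bar> < \<epsilon>" using le[of x] by (intro exI[of _ x]) auto
  qed
  then show ?thesis using that le by force
qed

text \<open>A weighted series of the truncated \<open>\<bar>p i\<bar>\<close> merges countably many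
  conditions into a single continuous function whose zeros are exactly the common zeros.\<close>

lemma pseudocompact_common_zero:
  fixes p :: "nat \<Rightarrow> 'a::topological_space \<Rightarrow> real"
  assumes pc: "pseudocompact_space (euclidean :: 'a topology)"
    and cont: "\<And>i. continuous_on UNIV (p i)"
    and small: "\<And>n \<epsilon>. \<epsilon> > 0 \<Longrightarrow> \<exists>y. \<forall>i<n. \<bar>p i y\<bar> < \<epsilon>"
  shows "\<exists>y. \<forall>i. p i y = 0"
proof -
  define q where "q = (\<lambda>i y. (1/2)^i * min 1 \<bar>p i y\<bar>)"
  define F where "F = (\<lambda>y. \<Sum>i. q i y)"
  have q: "0 \<le> q i y" "q i y \<le> (1/2)^i" for i y
    by (auto simp: q_def mult_le_cancel_left1)
  have sq: "summable (\<lambda>i. q i y)" for y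
    by (rule summable_comparison_test'[OF summable_geometric[of "1/2::real"], of 0]) (use q in auto)
  have "uniform_limit UNIV (\<lambda>n y. \<Sum>i<n. q i y) F sequentially"
    unfolding F_def
    by (rule Weierstrass_m_test[where M = "\<lambda>i. (1/2)^i"]) (use q in \<open>auto intro: summable_geometric\<close>)
  then have "continuous_on UNIV F"
    by (rule uniform_limit_theorem[rotated])
      (auto simp: q_def intro!: always_eventually continuous_intros cont)
  moreover have "\<exists>y. \<bar>F y\<bar> < \<epsilon>" if "\<epsilon> > 0" for \<epsilon>
  proof -
    \<comment> \<open>The tail of the series is at most \<open>2 * (1/2)^n < \<epsilon> / 2\<close>,
      the head at most \<open>2 * (\<epsilon> / 4)\<close>.\<close>
    obtain n where n: "(1/2)^n < \<epsilon> / 4"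
      using real_arch_pow_inv[of "\<epsilon>/4" "1/2"] \<open>\<epsilon> > 0\<close> by auto
    obtain y where y: "\<forall>i<n. \<bar>p i y\<bar> < \<epsilon> / 4" using small[of "\<epsilon> / 4" n] \<open>\<epsilon> > 0\<close> by auto
    have "F y = (\<Sum>i. q (i + n) y) + (\<Sum>i<n. q i y)"
      unfolding F_def using suminf_split_initial_segment[OF sq] .
    moreover have "(\<Sum>i. q (i + n) y) \<le> (\<Sum>i. (1/2)^n * (1/2)^i)"
      using q(2)[of "_ + n" y]
      by (intro suminf_le summable_mult summable_geometric summable_ignore_initial_segment sq)
        (auto simp: power_add mult.commute)
    moreover have "(\<Sum>i. (1/2)^n * (1/2)^i :: real) = 2 * (1/2)^n"
      by (subst suminf_mult) (auto simp: suminf_geometric intro: summable_geometric)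
    moreover have "(\<Sum>i<n. q i y) \<le> (\<Sum>i<n. (1/2)^i * (\<epsilon> / 4))"
      using y by (intro sum_mono) (auto simp: q_def intro!: mult_left_mono)
    moreover have "(\<Sum>i<n. (1/2)^i * (\<epsilon> / 4)) \<le> 2 * (\<epsilon> / 4)"
      unfolding sum_distrib_right[symmetric] using \<open>\<epsilon> > 0\<close>
      by (intro mult_right_mono) (auto simp: geometric_sum)
    ultimately have "F y < \<epsilon>" using n by linarith
    moreover have "F y \<ge> 0" unfolding F_def using q sq by (intro suminf_nonneg) auto
    ultimately have "\<bar>F y\<bar> < \<epsilon>" by simp
    then show ?thesis ..
  qed
  ultimately obtain y where "F y = 0" using pseudocompact_has_zero[OF pc] by blast
  then have "q i y = 0" for i
    using suminf_eq_zero_iff[OF sq q(1)] by (simp add: F_def)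
  then have "p i y = 0" for i
    unfolding q_def by (metis abs_eq_0 min_def mult_eq_0_iff power_not_zero zero_neq_one divide_eq_0_iff zero_neq_numeral)
  then show ?thesis by blast
qed

section \<open>Finite nets, dyadic series and Simons' inequality\<close>

text \<open>Points are sorted by the integer parts of \<open>f i x / \<epsilon>\<close>. Boundedness
  leaves finitely many classes, and one representative of each forms the net.\<close>

lemma finite_net:
  fixes f :: "'i \<Rightarrow> 'a::topological_space \<Rightarrow>\<^sub>C real"
  assumes "finite I" "\<epsilon> > 0"
  shows "\<exists>D. finite D \<and> (\<forall>x. \<exists>d\<in>D. \<forall>i\<in>I. \<bar>apply_bcontfun (f i) x - apply_bcontfun (f i) d\<bar> < \<epsilon>)"
proof -
  define k where "k = (\<lambda>x. \<lambda>i\<in>I. \<lfloor>apply_bcontfun (f i) x / \<epsilon>\<rfloor>)"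
  have k_range: "k x \<in> PiE I (\<lambda>i. {\<lfloor>- norm (f i) / \<epsilon>\<rfloor>..\<lfloor>norm (f i) / \<epsilon>\<rfloor>})" for x
  proof -
    have "- norm (f i) / \<epsilon> \<le> apply_bcontfun (f i) x / \<epsilon>" "apply_bcontfun (f i) x / \<epsilon> \<le> norm (f i) / \<epsilon>" for i
      using norm_bounded[of "f i" x] \<open>\<epsilon> > 0\<close> by (intro divide_right_mono; simp add: abs_le_iff)+
    then show ?thesis
      unfolding k_def restrict_PiE_iff atLeastAtMost_iff by (intro ballI conjI floor_mono)
  qed
  have "finite (range k)"
  proof (rule finite_subset)
    show "range k \<subseteq> PiE I (\<lambda>i. {\<lfloor>- norm (f i) / \<epsilon>\<rfloor>..\<lfloor>norm (f i) / \<epsilon>\<rfloor>})"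
      using k_range by blast
  qed (use \<open>finite I\<close> in \<open>auto intro: finite_PiE\<close>)
  moreover have "\<exists>d\<in>inv k ` range k. \<forall>i\<in>I. \<bar>apply_bcontfun (f i) x - apply_bcontfun (f i) d\<bar> < \<epsilon>" for x
  proof (intro bexI ballI)
    fix i assume "i \<in> I"
    have "k (inv k (k x)) = k x" by (simp add: f_inv_into_f)
    then have "\<lfloor>apply_bcontfun (f i) (inv k (k x)) / \<epsilon>\<rfloor> = \<lfloor>apply_bcontfun (f i) x / \<epsilon>\<rfloor>"
      using \<open>i \<in> I\<close> by (auto simp: k_def dest: fun_cong[of _ _ i])
    then have "\<bar>apply_bcontfun (f i) x / \<epsilon> - apply_bcontfun (f i) (inv k (k x)) / \<epsilon>\<bar> < 1"
      by linarith
    then show "\<bar>apply_bcontfun (f i) x - apply_bcontfun (f i) (inv k (k x))\<bar> < \<epsilon>"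
      using \<open>\<epsilon> > 0\<close> by (simp add: diff_divide_distrib[symmetric] abs_divide)
  qed auto
  ultimately show ?thesis by blast
qed

text \<open>The weights sum to 1. A partial sum becomes a convex combination when the missing weight
  \<open>(1/2)^m\<close> is put on \<open>y m\<close>, and this correction tends to 0.\<close>

lemma closed_convex_dyadic_sum:
  fixes y :: "nat \<Rightarrow> 'v::banach"
  assumes "closed C" "convex C" "\<And>n. y n \<in> C" "\<And>n. norm (y n) \<le> M"
  shows "summable (\<lambda>j. (1/2)^Suc j *\<^sub>R y j)" "(\<Sum>j. (1/2)^Suc j *\<^sub>R y j) \<in> C"
proof -
  have nb: "norm ((1/2)^Suc j *\<^sub>R y j) \<le> M * (1/2)^Suc j" for j
    using assms(4)[of j] by (simp add: field_simps)
  show s: "summable (\<lambda>j. (1/2)^Suc j *\<^sub>R y j)"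
    by (rule summable_comparison_test'[of "\<lambda>j. M * (1/2)^Suc j" 0])
      (use nb in \<open>auto intro!: summable_mult summable_geometric simp del: power_Suc
        simp: summable_Suc_iff[of "\<lambda>n. (1/2 :: real)^n"]\<close>)
  have part: "(\<Sum>j<m. (1/2)^Suc j *\<^sub>R z j) + (1/2)^m *\<^sub>R z m \<in> C" if "\<And>n. z n \<in> C" for z m
    using that
  proof (induction m arbitrary: z)
    case 0
    then show ?case by simp
  next
    case (Suc m)
    \<comment> \<open>The combination is the midpoint of \<open>z 0\<close> and the shorter
      combination for the shifted sequence.\<close>
    have "(1/2) *\<^sub>R z 0 + (1/2) *\<^sub>R ((\<Sum>j<m. (1/2)^Suc j *\<^sub>R z (Suc j)) + (1/2)^m *\<^sub>R z (Suc m)) \<in> C"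
      using Suc.prems Suc.IH[of "\<lambda>j. z (Suc j)"] \<open>convex C\<close> by (intro convexD) auto
    then show ?case
      by (simp add: sum.lessThan_Suc_shift scaleR_sum_right scaleR_add_right add.assoc del: sum.lessThan_Suc)
  qed
  have "(\<lambda>m. (1/2)^m * M) \<longlonglongrightarrow> 0"
    by (intro tendsto_mult_left_zero LIMSEQ_power_zero) auto
  then have "(\<lambda>m. (1/2)^m *\<^sub>R y m) \<longlonglongrightarrow> 0"
    by (rule Lim_null_comparison[rotated]) (use assms(4) in \<open>auto intro!: always_eventually mult_left_mono\<close>)
  then have "(\<lambda>m. (\<Sum>j<m. (1/2)^Suc j *\<^sub>R y j) + (1/2)^m *\<^sub>R y m) \<longlonglongrightarrow> (\<Sum>j. (1/2)^Suc j *\<^sub>R y j) + 0"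
    using summable_LIMSEQ[OF s] by (intro tendsto_add)
  then show "(\<Sum>j. (1/2)^Suc j *\<^sub>R y j) \<in> C"
    using \<open>closed C\<close> part[OF assms(3)] closed_sequentially by fastforce
qed

text \<open>The library has this instance only for metric domains.\<close>

instance bcontfun :: (topological_space, complete_space) complete_space
proof
  fix f :: "nat \<Rightarrow> 'a \<Rightarrow>\<^sub>C 'b"
  assume f: "Cauchy f"
  have "\<forall>e>0. \<exists>N. \<forall>m n x. N \<le> m \<and> N \<le> n \<and> True \<longrightarrow> dist (f m x) (f n x) < e"
    by (meson f Cauchy_def dist_fun_lt_imp_dist_val_lt)
  then have "\<exists>l. \<forall>e>0. \<exists>N. \<forall>n x. N \<le> n \<and> True \<longrightarrow> dist (f n x) (l x) < e"
    by (subst uniformly_convergent_eq_cauchy)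
  then obtain l where "uniform_limit UNIV f l sequentially"
    by (auto simp: uniform_limit_sequentially_iff)
  then show "convergent f"
    by (rule uniform_limit_bcontfunE) (auto intro: convergentI)
qed

instance bcontfun :: (topological_space, banach) banach ..

text \<open>The case of Simons' inequality in which the sequence tends to 0 pointwise. The \<open>g n\<close> nearly
  minimise the supremum of \<open>h n + 2\<^sup>-\<^sup>n g\<close> over the closed convex hull \<open>C n\<close> of the \<open>n\<close>-th tail.
  At a maximum point \<open>b\<close> of \<open>t 0 = \<Sum> 2\<^sup>-\<^sup>k\<^sup>-\<^sup>1 g k\<close> this keeps the tails \<open>t n \<in> C n\<close>
  from dropping below \<open>\<epsilon> / 2\<close>, so that \<open>f k b\<close> cannot tend to 0.\<close>

lemma simons_null_sequence:
  fixes f :: "nat \<Rightarrow> 'a::topological_space \<Rightarrow>\<^sub>C real"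
  assumes pc: "pseudocompact_space (euclidean :: 'a topology)"
    and bd: "\<And>n. norm (f n) \<le> M"
    and null: "\<And>x. (\<lambda>n. apply_bcontfun (f n) x) \<longlonglongrightarrow> 0"
    and "\<epsilon> > 0"
  shows "\<exists>g \<in> convex hull (range f). \<forall>x. apply_bcontfun g x < \<epsilon>"
proof (rule ccontr)
  assume contr: "\<not> ?thesis"
  define C where "C n = closure (convex hull (f ` {n..}))" for n
  define S where "S g = (SUP x. apply_bcontfun g x)" for g :: "'a \<Rightarrow>\<^sub>C real"
  define r where "r n = ((1/2)^n :: real)" for n
  \<comment> \<open>The factor \<open>r n\<close> cancels when the near-minimality estimate is
    divided by \<open>r n\<close>. The remaining errors \<open>r (Suc n) * (\<epsilon> / 4)\<close>
    add up to \<open>\<epsilon> / 4\<close>.\<close>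
  define \<delta> where "\<delta> n = r n * (r (Suc n) * (\<epsilon> / 4))" for n
  have r: "r n > 0" "r (Suc n) = r n / 2" "r 0 = 1" for n by (auto simp: r_def)
  have \<delta>: "\<delta> n > 0" for n using \<open>\<epsilon> > 0\<close> r by (simp add: \<delta>_def)
  have C: "closed (C n)" "convex (C n)" "C (m + n) \<subseteq> C n" "f n \<in> C n" for n m
    unfolding C_def
    by (auto intro!: convex_closure closure_mono hull_mono subsetD[OF closure_subset] hull_inc)
  have C_norm: "norm g \<le> M" if "g \<in> C n" for g n
  proof -
    have "C n \<subseteq> cball 0 M"
      unfolding C_def using bd by (intro closure_minimal hull_minimal) auto
    then show ?thesis using that by auto
  qed
  have C_le: "apply_bcontfun g x \<le> c" if "g \<in> C n" "\<And>k. k \<ge> n \<Longrightarrow> apply_bcontfun (f k) x \<le> c" for g n x c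
  proof -
    have lin: "bounded_linear (\<lambda>\<phi> :: 'a \<Rightarrow>\<^sub>C real. apply_bcontfun \<phi> x)"
      using blinfun.bounded_linear_right[of "bcontfun_eval x"] by simp
    have eq: "{g. apply_bcontfun g x \<le> c} = (\<lambda>\<phi> :: 'a \<Rightarrow>\<^sub>C real. apply_bcontfun \<phi> x) -` {..c}" by auto
    have "C n \<subseteq> {g. apply_bcontfun g x \<le> c}"
      unfolding C_def
    proof (intro closure_minimal hull_minimal)
      show "convex {g :: 'a \<Rightarrow>\<^sub>C real. apply_bcontfun g x \<le> c}"
        unfolding eq using lin by (intro convex_linear_vimage) (auto simp: convex_real_interval bounded_linear.linear)
      show "closed {g :: 'a \<Rightarrow>\<^sub>C real. apply_bcontfun g x \<le> c}"
        by (intro closed_Collect_le linear_continuous_on lin continuous_intros)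
    qed (use that(2) in auto)
    then show ?thesis using that(1) by auto
  qed
  have S_upper: "apply_bcontfun g x \<le> S g" for g x
    unfolding S_def by (intro cSUP_upper bdd_above_bcontfun) auto
  have S_lower: "S g \<ge> - norm g" for g
  proof -
    fix x0
    have "- norm g \<le> apply_bcontfun g x0" using norm_bounded[of g x0] by (simp add: abs_le_iff)
    then show ?thesis using S_upper[of g x0] by linarith
  qed
  \<comment> \<open>The infimum is finite since \<open>S\<close> is bounded below on bounded sets.
    \<open>v\<close> is arbitrary because the \<open>h n\<close> to be inserted depends on earlier
    choices.\<close>
  have "\<exists>g. g \<in> C n \<and> (\<forall>g'\<in>C n. S (v + r n *\<^sub>R g) \<le> S (v + r n *\<^sub>R g') + \<delta> n)" for n v
  proof -
    let ?I = "INF g\<in>C n. S (v + r n *\<^sub>R g)"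
    have bdd: "bdd_below ((\<lambda>g. S (v + r n *\<^sub>R g)) ` C n)"
    proof (rule bdd_belowI2)
      fix g assume "g \<in> C n"
      then have "norm (v + r n *\<^sub>R g) \<le> norm v + r n * M"
        using C_norm r(1)[of n] by (intro norm_triangle_mono) auto
      then show "- (norm v + r n * M) \<le> S (v + r n *\<^sub>R g)" using S_lower[of "v + r n *\<^sub>R g"] by linarith
    qed
    have "?I < ?I + \<delta> n" using \<delta> by simp
    then obtain g where "g \<in> C n" "S (v + r n *\<^sub>R g) < ?I + \<delta> n"
      using cINF_less_iff[OF _ bdd] C(4) by blast
    moreover have "?I \<le> S (v + r n *\<^sub>R g')" if "g' \<in> C n" for g'
      using bdd that by (rule cINF_lower)
    ultimately show ?thesis by force
  qed
  then obtain G where G: "\<And>n v. G n v \<in> C n"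
      "\<And>n v g'. g' \<in> C n \<Longrightarrow> S (v + r n *\<^sub>R G n v) \<le> S (v + r n *\<^sub>R g') + \<delta> n"
    by metis
  \<comment> \<open>The minimisation gives \<open>g n\<close> the weight \<open>r n\<close>, but
    only half of it is added to \<open>h n\<close>. The weight left over is that of the tail, so
    \<open>t 0 = h n + r n *\<^sub>R t n\<close> and \<open>t n\<close> competes with
    \<open>g n\<close>.\<close>
  define h where "h = rec_nat 0 (\<lambda>n v. v + r (Suc n) *\<^sub>R G n v)"
  have h: "h 0 = 0" "h (Suc n) = h n + r (Suc n) *\<^sub>R G n (h n)" for n by (auto simp: h_def)
  define g where "g n = G n (h n)" for n
  define t where "t n = (\<Sum>j. (1/2)^Suc j *\<^sub>R g (n + j))" for n
  have gC: "g (n + j) \<in> C n" for n j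
    using G(1)[of "n + j" "h (n + j)"] C(3)[of j n] by (auto simp: g_def add.commute)
  have gn: "norm (g n) \<le> M" for n using C_norm gC[of n 0] by simp
  have summ: "summable (\<lambda>j. (1/2)^Suc j *\<^sub>R g (n + j))" and tC: "t n \<in> C n" for n
    unfolding t_def using closed_convex_dyadic_sum[of "C n" "\<lambda>j. g (n + j)" M] C gC gn by auto
  have t_step: "t n = (1/2) *\<^sub>R g n + (1/2) *\<^sub>R t (Suc n)" for n
  proof -
    have "t n = (1/2) *\<^sub>R g n + (\<Sum>j. (1/2)^Suc (Suc j) *\<^sub>R g (n + Suc j))"
      using suminf_split_head[OF summ[of n]] by (simp add: t_def algebra_simps)
    also have "(\<Sum>j. (1/2)^Suc (Suc j) *\<^sub>R g (n + Suc j)) = (1/2) *\<^sub>R t (Suc n)"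
      unfolding t_def using suminf_scaleR_right[OF summ[of "Suc n"], of "1/2"] by simp
    finally show ?thesis .
  qed
  have ht: "t 0 = h n + r n *\<^sub>R t n" for n
  proof (induction n)
    case (Suc n)
    then show ?case
      by (simp add: h r(2) t_step[of n] g_def algebra_simps)
  qed (simp add: h r)
  obtain b where b: "\<And>x. apply_bcontfun (t 0) x \<le> apply_bcontfun (t 0) b"
    using pseudocompact_attains_sup[OF pc] by blast
  have St: "S (t 0) \<le> apply_bcontfun (t 0) b"
    unfolding S_def by (rule cSUP_least) (use b in auto)
  \<comment> \<open>Near-minimality compares suprema. Replacing \<open>g n\<close> by
    \<open>t n\<close> gives \<open>t 0\<close>, whose supremum is its value at \<open>b\<close>, so
    the comparison becomes one of values at \<open>b\<close>.\<close>
  have g_le: "apply_bcontfun (g n) b \<le> apply_bcontfun (t n) b + r (Suc n) * (\<epsilon> / 4)" for n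
  proof -
    have "apply_bcontfun (h n + r n *\<^sub>R g n) b \<le> S (h n + r n *\<^sub>R g n)" by (rule S_upper)
    also have "\<dots> \<le> S (h n + r n *\<^sub>R t n) + \<delta> n" unfolding g_def by (rule G(2)[OF tC])
    also have "\<dots> \<le> apply_bcontfun (h n + r n *\<^sub>R t n) b + \<delta> n" using St ht[of n] by simp
    finally have "r n * apply_bcontfun (g n) b \<le> r n * (apply_bcontfun (t n) b + r (Suc n) * (\<epsilon> / 4))"
      by (simp add: \<delta>_def algebra_simps)
    then show ?thesis using r(1)[of n] by simp
  qed
  \<comment> \<open>\<open>t n\<close> is the midpoint of \<open>g n\<close> and
    \<open>t (Suc n)\<close>, so each step loses at most the error in \<open>g_le\<close>; the
    losses add up to the stated amount.\<close>
  have t_ge: "apply_bcontfun (t n) b \<ge> apply_bcontfun (t 0) b - (1 - r n) * (\<epsilon> / 4)" for n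
  proof (induction n)
    case (Suc n)
    have "apply_bcontfun (t n) b = apply_bcontfun (g n) b / 2 + apply_bcontfun (t (Suc n)) b / 2"
      by (subst t_step) simp
    then have "apply_bcontfun (t (Suc n)) b \<ge> apply_bcontfun (t n) b - r (Suc n) * (\<epsilon> / 4)"
      using g_le[of n] by linarith
    moreover have "(1 - r (Suc n)) * (\<epsilon> / 4) = (1 - r n) * (\<epsilon> / 4) + r (Suc n) * (\<epsilon> / 4)"
      by (simp add: r(2) field_simps)
    ultimately show ?case using Suc.IH by linarith
  qed (simp add: r)
  \<comment> \<open>\<open>t 0\<close> lies only in the closure, so the assumption is applied to a
    nearby \<open>a\<close> in the hull itself. This leaves \<open>3/4 * \<epsilon>\<close> at
    \<open>b\<close>, of which at least \<open>\<epsilon> / 2\<close> survives in every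
    \<open>t n\<close>.\<close>
  have "t 0 \<in> closure (convex hull (range f))" using tC[of 0] by (simp add: C_def atLeast_0)
  then obtain a where a: "a \<in> convex hull (range f)" "dist a (t 0) < \<epsilon> / 4"
    using \<open>\<epsilon> > 0\<close> unfolding closure_approachable by (meson divide_pos_pos zero_less_numeral)
  obtain x where "apply_bcontfun a x \<ge> \<epsilon>" using contr a(1) by (auto simp: not_less)
  moreover have "\<bar>apply_bcontfun a x - apply_bcontfun (t 0) x\<bar> < \<epsilon> / 4"
    using dist_bounded[of a x "t 0"] a(2) by (simp add: dist_real_def)
  ultimately have t0: "apply_bcontfun (t 0) b > \<epsilon> * 3 / 4" using b[of x] by linarith
  obtain n where n: "\<And>k. k \<ge> n \<Longrightarrow> apply_bcontfun (f k) b < \<epsilon> / 4"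
    using order_tendstoD(2)[OF null[of b], of "\<epsilon> / 4"] \<open>\<epsilon> > 0\<close> by (auto simp: eventually_sequentially)
  have "apply_bcontfun (t n) b \<le> \<epsilon> / 4"
    using n by (intro C_le[OF tC]) (auto intro: less_imp_le)
  moreover have "(1 - r n) * (\<epsilon> / 4) \<le> 1 * (\<epsilon> / 4)"
    using r(1)[of n] \<open>\<epsilon> > 0\<close> by (intro mult_right_mono) auto
  ultimately show False using t_ge[of n] t0 \<open>\<epsilon> > 0\<close> by linarith
qed

section \<open>The pointwise closure\<close>

text \<open>Product topologies need not admit convergent subsequences, so a point in the closures of
  all tails is used. \<open>J\<close> restricts the tails to chosen indices.\<close>

lemma compact_sequence_cluster_point:
  assumes "compact K" "infinite J" "\<And>n :: nat. s n \<in> K"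
  obtains u where "u \<in> K" "\<And>N. u \<in> closure (s ` {n \<in> J. N \<le> n})"
proof -
  have "K \<inter> (\<Inter>N\<in>UNIV. closure (s ` {n \<in> J. N \<le> n})) \<noteq> {}"
  proof (rule compact_imp_fip_image[OF \<open>compact K\<close>])
    fix I :: "nat set" assume "finite I"
    obtain n where n: "n \<in> J" "Max (insert 0 I) \<le> n"
      using \<open>infinite J\<close> by (meson infinite_nat_iff_unbounded_le)
    have "s n \<in> closure (s ` {n \<in> J. N \<le> n})" if "N \<in> I" for N
    proof (rule subsetD[OF closure_subset])
      have "N \<le> n" using n(2) that \<open>finite I\<close> by simp
      then show "s n \<in> s ` {n \<in> J. N \<le> n}" using n(1) by blast
    qed
    then show "K \<inter> (\<Inter>N\<in>I. closure (s ` {n \<in> J. N \<le> n})) \<noteq> {}" using assms(3) by blast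
  qed auto
  then show ?thesis using that by blast
qed

text \<open>Ensures that cluster points in the function space are again bounded continuous
  functions.\<close>

lemma relatively_compact_bcontfun_imp_compact:
  assumes "relatively_compactin bcontfun_pointwise_topology A"
  shows "compact (apply_bcontfun ` (bcontfun_pointwise_topology closure_of A))"
proof -
  have "continuous_map bcontfun_pointwise_topology euclidean apply_bcontfun"
    unfolding bcontfun_pointwise_topology_def
    using continuous_map_pullback[OF continuous_map_id] by (metis comp_id id_comp)
  then have "compactin euclidean (apply_bcontfun ` (bcontfun_pointwise_topology closure_of A))"
    using assms by (intro image_compactin) (auto simp: relatively_compactin_def)
  then show ?thesis by simp
qed

text \<open>The construction of Eberlein and Grothendieck: \<open>\<psi> n\<close> is close to \<open>\<Phi>\<close> on finite sets \<open>E\<close> which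
  are nets for the earlier differences \<open>f i = \<psi> i - \<Phi>\<close>. A cluster point \<open>u\<close> equals \<open>\<Phi>\<close> on all of
  these sets. By pseudocompactness some \<open>y\<close> has \<open>u y = \<Phi> y\<close> and \<open>f i y = f i x\<close> for all \<open>i\<close>,
  and the last condition forces \<open>u x - \<Phi> x = u y - \<Phi> y = 0\<close>.\<close>

lemma pointwise_closure_sequence:
  fixes A :: "('a::topological_space \<Rightarrow>\<^sub>C real) set"
  assumes pc: "pseudocompact_space (euclidean :: 'a topology)"
    and rc: "relatively_compactin bcontfun_pointwise_topology A"
    and \<Phi>: "\<Phi> \<in> bcontfun_pointwise_topology closure_of A"
  obtains \<psi> where "\<And>n. \<psi> n \<in> A"
    "\<And>x. (\<lambda>n. apply_bcontfun (\<psi> n - \<Phi>) x) \<longlonglongrightarrow> 0"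
proof -
  let ?K = "bcontfun_pointwise_topology closure_of A"
  have "apply_bcontfun \<Phi> \<in> closure (apply_bcontfun ` A)"
    using \<Phi> by (simp add: bcontfun_pointwise_topology_def in_closure_of_pullback_iff)
  then have "\<exists>\<psi>\<in>A. \<forall>d\<in>E. \<bar>apply_bcontfun (\<psi> - \<Phi>) d\<bar> < inverse (of_nat (Suc n))"
    if "finite E" for E n
    using closure_witness[of "apply_bcontfun \<Phi>" "apply_bcontfun ` A" E "inverse (of_nat (Suc n))"] that by auto
  then obtain P where P: "\<And>E n. finite E \<Longrightarrow> P E n \<in> A"
    "\<And>E n d. finite E \<Longrightarrow> d \<in> E \<Longrightarrow> \<bar>apply_bcontfun (P E n - \<Phi>) d\<bar> < inverse (of_nat (Suc n))"
    by metis
  have "\<exists>D. finite D \<and> (\<forall>x. \<exists>d\<in>D. \<forall>g\<in>F. \<bar>apply_bcontfun g x - apply_bcontfun g d\<bar> < inverse (of_nat (Suc n)))"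
    if "finite F" for F :: "('a \<Rightarrow>\<^sub>C real) set" and n
    using finite_net[OF that, of "inverse (of_nat (Suc n))" "\<lambda>g. g"] by auto
  then obtain N where N: "\<And>F n. finite F \<Longrightarrow> finite (N F n)"
    "\<And>F n x. finite F \<Longrightarrow> \<exists>d\<in>N F n. \<forall>g\<in>F. \<bar>apply_bcontfun (g :: 'a \<Rightarrow>\<^sub>C real) x - apply_bcontfun g d\<bar> < inverse (of_nat (Suc n))"
    by metis
  \<comment> \<open>\<open>F n\<close> holds the differences \<open>f i\<close> for
    \<open>i < n\<close>. A net for them is added to \<open>E n\<close> before
    \<open>\<psi> n\<close> is chosen, so \<open>\<psi> n\<close> is close to \<open>\<Phi>\<close>
    already on \<open>E (Suc n)\<close>.\<close>
  define st where "st = rec_nat ({}, {}) (\<lambda>n (F, E). (insert (P (E \<union> N F n) n - \<Phi>) F, E \<union> N F n))"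
  define F where "F n = fst (st n)" for n
  define E where "E n = snd (st n)" for n
  define \<psi> where "\<psi> n = P (E (Suc n)) n" for n
  define f where "f n = \<psi> n - \<Phi>" for n
  have E: "E (Suc n) = E n \<union> N (F n) n" for n
    by (simp add: E_def F_def st_def case_prod_unfold)
  have F: "F (Suc n) = insert (f n) (F n)" for n
    by (simp add: f_def \<psi>_def E) (simp add: E_def F_def st_def case_prod_unfold)
  have finF: "finite (F n)" for n
    by (induction n) (simp_all add: F, simp add: F_def st_def)
  have finE: "finite (E n)" for n
    by (induction n) (simp_all add: E N(1) finF, simp add: E_def st_def)
  have monoE: "E m \<subseteq> E n" if "m \<le> n" for m n
    using that by (rule lift_Suc_mono_le[rotated]) (auto simp: E)
  have fF: "f i \<in> F n" if "i < n" for i n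
    using that by (induction n) (auto simp: F less_Suc_eq)
  have \<psi>A: "\<psi> n \<in> A" for n by (simp add: \<psi>_def P(1) finE)
  have small: "\<bar>apply_bcontfun (f n) d\<bar> < inverse (of_nat (Suc n))" if "d \<in> E m" "m \<le> n" for n m d
    unfolding f_def \<psi>_def using monoE[of m "Suc n"] that by (intro P(2) finE) auto
  have net: "\<exists>d\<in>E (Suc n). \<forall>i<n. \<bar>apply_bcontfun (f i) x - apply_bcontfun (f i) d\<bar> < inverse (of_nat (Suc n))" for n x
  proof -
    obtain d where "d \<in> N (F n) n"
      "\<forall>g\<in>F n. \<bar>apply_bcontfun g x - apply_bcontfun g d\<bar> < inverse (of_nat (Suc n))"
      using N(2)[OF finF] by blast
    then show ?thesis using fF by (intro bexI[of _ d]) (auto simp: E)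
  qed
  have "(\<lambda>n. apply_bcontfun (f n) x) \<longlonglongrightarrow> 0" for x
  proof (rule ccontr)
    assume "\<not> ?thesis"
    then obtain \<eta> where "\<eta> > 0" and \<eta>: "\<And>N. \<exists>n\<ge>N. \<bar>apply_bcontfun (f n) x\<bar> \<ge> \<eta>"
      by (auto simp: LIMSEQ_def dist_real_def not_less)
    \<comment> \<open>Clustering along these indices keeps \<open>u x\<close> at distance at least
      \<open>\<eta>\<close> from \<open>\<Phi> x\<close>.\<close>
    define J where "J = {n. \<bar>apply_bcontfun (f n) x\<bar> \<ge> \<eta>}"
    have "infinite J" using \<eta> by (auto simp: infinite_nat_iff_unbounded_le J_def)
    have "A \<subseteq> ?K"
      by (rule closure_of_subset) (simp add: bcontfun_pointwise_topology_def topspace_pullback_topology)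
    then have "apply_bcontfun (\<psi> n) \<in> apply_bcontfun ` ?K" for n using \<psi>A by blast
    then obtain u where "u \<in> apply_bcontfun ` ?K"
      and u: "\<And>N. u \<in> closure ((\<lambda>n. apply_bcontfun (\<psi> n)) ` {n \<in> J. N \<le> n})"
      using compact_sequence_cluster_point[OF relatively_compact_bcontfun_imp_compact[OF rc] \<open>infinite J\<close>, of "\<lambda>n. apply_bcontfun (\<psi> n)"]
      by blast
    then obtain v where v: "u = apply_bcontfun v" by blast
    have uD: "u d = apply_bcontfun \<Phi> d" if "d \<in> E m" for d m
    proof (rule ccontr)
      assume "u d \<noteq> apply_bcontfun \<Phi> d"
      then obtain n where n: "inverse (of_nat (Suc n)) < \<bar>u d - apply_bcontfun \<Phi> d\<bar>"
        using reals_Archimedean[of "\<bar>u d - apply_bcontfun \<Phi> d\<bar>"] by auto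
      have "\<bar>u d - apply_bcontfun \<Phi> d\<bar> \<le> inverse (of_nat (Suc n))"
      proof (rule closure_subset_closed_property[OF u[of "max m n"], where P = "\<lambda>u. \<bar>u d - apply_bcontfun \<Phi> d\<bar> \<le> inverse (of_nat (Suc n))"])
        show "closed {u. \<bar>u d - apply_bcontfun \<Phi> d\<bar> \<le> inverse (of_nat (Suc n))}"
          by (intro closed_Collect_le continuous_intros) auto
      next
        fix w assume "w \<in> (\<lambda>n. apply_bcontfun (\<psi> n)) ` {k \<in> J. max m n \<le> k}"
        then obtain k where k: "w = apply_bcontfun (\<psi> k)" "m \<le> k" "n \<le> k" by auto
        have "inverse (real (Suc k)) \<le> inverse (real (Suc n))"
          using k(3) by (intro le_imp_inverse_le) auto
        then have "\<bar>apply_bcontfun (f k) d\<bar> \<le> inverse (of_nat (Suc n))"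
          using small[OF that k(2)] by linarith
        then show "\<bar>w d - apply_bcontfun \<Phi> d\<bar> \<le> inverse (of_nat (Suc n))"
          by (simp add: k(1) f_def)
      qed
      then show False using n by simp
    qed
    have ux: "\<bar>u x - apply_bcontfun \<Phi> x\<bar> \<ge> \<eta>"
      by (rule closure_subset_closed_property[OF u[of 0], where P = "\<lambda>u. \<bar>u x - apply_bcontfun \<Phi> x\<bar> \<ge> \<eta>"])
        (auto simp: J_def f_def intro!: closed_Collect_le continuous_intros)
    \<comment> \<open>Index 0 encodes agreement with \<open>\<Phi>\<close>, through \<open>v\<close>
      because continuity is needed; the successors encode that \<open>f i\<close> does not separate
      \<open>y\<close> from \<open>x\<close>.\<close>
    define p where "p i y = (case i of 0 \<Rightarrow> apply_bcontfun v y - apply_bcontfun \<Phi> y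
      | Suc i \<Rightarrow> apply_bcontfun (f i) y - apply_bcontfun (f i) x)" for i y
    have "\<exists>y. \<forall>i. p i y = 0"
    proof (rule pseudocompact_common_zero[OF pc])
      show "continuous_on UNIV (p i)" for i
        by (cases i) (auto simp: p_def intro!: continuous_intros)
    next
      fix n and \<epsilon> :: real assume "\<epsilon> > 0"
      then obtain m where m: "inverse (real (Suc m)) < \<epsilon>" using reals_Archimedean by auto
      \<comment> \<open>\<open>m\<close> sets the precision and \<open>n\<close> the number of
        conditions. Since \<open>d\<close> lies in one of the sets \<open>E\<close>, the condition
        of index 0 holds there exactly.\<close>
      obtain d where d: "d \<in> E (Suc (max m n))"
        "\<forall>i<max m n. \<bar>apply_bcontfun (f i) x - apply_bcontfun (f i) d\<bar> < inverse (of_nat (Suc (max m n)))"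
        using net by blast
      have "inverse (real (Suc (max m n))) \<le> inverse (real (Suc m))"
        by (intro le_imp_inverse_le) auto
      then have "\<forall>i<n. \<bar>apply_bcontfun (f i) d - apply_bcontfun (f i) x\<bar> < \<epsilon>"
        using d(2) m by (smt (verit) less_max_iff_disj max.commute)
      then have "\<forall>i<n. \<bar>p i d\<bar> < \<epsilon>"
        using uD[OF d(1)] \<open>\<epsilon> > 0\<close> by (auto simp: p_def v split: nat.split)
      then show "\<exists>y. \<forall>i<n. \<bar>p i y\<bar> < \<epsilon>" ..
    qed
    then obtain y where y: "\<And>i. p i y = 0" by blast
    have fy: "apply_bcontfun (f i) y = apply_bcontfun (f i) x" for i
      using y[of "Suc i"] by (simp add: p_def)
    have "u y - apply_bcontfun \<Phi> y = u x - apply_bcontfun \<Phi> x"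
      by (rule closure_subset_closed_property[OF u[of 0], where P = "\<lambda>u. u y - apply_bcontfun \<Phi> y = u x - apply_bcontfun \<Phi> x"])
        (use fy in \<open>auto simp: f_def intro!: closed_Collect_eq continuous_intros\<close>)
    then show False using ux y[of 0] \<open>\<eta> > 0\<close> by (simp add: p_def v)
  qed
  then show ?thesis using \<psi>A that[of \<psi>] by (simp add: f_def)
qed

lemma convex_pointwise_closure_dominated:
  fixes A :: "('a::topological_space \<Rightarrow>\<^sub>C real) set"
  assumes pc: "pseudocompact_space (euclidean :: 'a topology)"
    and rc: "relatively_compactin bcontfun_pointwise_topology A"
    and "bounded A" "convex A"
    and \<Phi>: "\<Phi> \<in> bcontfun_pointwise_topology closure_of A" and "\<epsilon> > 0"
  obtains \<psi> where "\<psi> \<in> A" "\<And>x. apply_bcontfun \<psi> x \<le> apply_bcontfun \<Phi> x + \<epsilon>"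
proof -
  obtain \<psi> where \<psi>: "\<And>n. \<psi> n \<in> A" "\<And>x. (\<lambda>n. apply_bcontfun (\<psi> n - \<Phi>) x) \<longlonglongrightarrow> 0"
    using pointwise_closure_sequence[OF pc rc \<Phi>] by blast
  obtain M where M: "\<And>\<phi>. \<phi> \<in> A \<Longrightarrow> norm \<phi> \<le> M"
    using \<open>bounded A\<close> by (auto simp: bounded_iff)
  have "norm (\<psi> n - \<Phi>) \<le> M + norm \<Phi>" for n
    using norm_triangle_ineq4[of "\<psi> n" \<Phi>] M[OF \<psi>(1)[of n]] by linarith
  then obtain g where g: "g \<in> convex hull (range (\<lambda>n. \<psi> n - \<Phi>))" "\<forall>x. apply_bcontfun g x < \<epsilon>"
    using simons_null_sequence[OF pc _ \<psi>(2) \<open>\<epsilon> > 0\<close>] by blast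
  \<comment> \<open>Thus the combination from Simons' inequality is itself a difference of a member
    of \<open>A\<close> and \<open>\<Phi>\<close>.\<close>
  have "convex ((+) (- \<Phi>) ` A)" using \<open>convex A\<close> by (rule convex_translation)
  then have "convex hull (range (\<lambda>n. \<psi> n - \<Phi>)) \<subseteq> (+) (- \<Phi>) ` A"
    using \<psi>(1) by (intro hull_minimal) auto
  then obtain \<phi> where "\<phi> \<in> A" "g = - \<Phi> + \<phi>" using g(1) by auto
  then show ?thesis using g(2) that[of \<phi>] by (auto simp: algebra_simps less_imp_le)
qed

text \<open>The functional found for \<open>A\<close> is kept: for \<open>\<psi>\<close> dominated
  by \<open>\<Phi> + \<epsilon>\<close>, monotonicity gives
  \<open>0 \<le> \<nu> \<psi> \<le> \<nu> \<Phi> + \<epsilon>\<close>.\<close>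

lemma some_functional_nonneg_on_pointwise_closure:
  fixes A :: "('a::topological_space \<Rightarrow>\<^sub>C real) set"
  assumes "pseudocompact_space (euclidean :: 'a topology)"
    and "relatively_compactin bcontfun_pointwise_topology A"
    and "bounded A" "convex A" "some_functional_nonneg_on A"
  shows "some_functional_nonneg_on (bcontfun_pointwise_topology closure_of A)"
proof -
  obtain \<nu> where \<nu>: "\<nu> \<in> eval_hull" "\<forall>\<Phi>\<in>A. blinfun_apply \<nu> \<Phi> \<ge> 0"
    using assms(5) by (auto simp: some_functional_nonneg_on_def)
  have "blinfun_apply \<nu> \<Phi> \<ge> 0" if \<Phi>: "\<Phi> \<in> bcontfun_pointwise_topology closure_of A" for \<Phi>
  proof (rule field_le_epsilon)
    fix \<epsilon> :: real assume "\<epsilon> > 0"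
    then obtain \<psi> where \<psi>: "\<psi> \<in> A" "\<And>x. apply_bcontfun \<psi> x \<le> apply_bcontfun \<Phi> x + \<epsilon>"
      using convex_pointwise_closure_dominated[OF assms(1-4) \<Phi>] by blast
    have "blinfun_apply \<nu> (\<psi> - \<Phi>) \<le> \<epsilon>"
      using \<psi>(2) by (intro eval_hull_le \<nu>(1)) (simp add: algebra_simps)
    then show "0 \<le> blinfun_apply \<nu> \<Phi> + \<epsilon>"
      using \<nu>(2) \<psi>(1) by (force simp: blinfun.diff_right)
  qed
  then show ?thesis using \<nu>(1) by (auto simp: some_functional_nonneg_on_def)
qed

theorem theorem1:
  fixes A :: "('a::topological_space \<Rightarrow>\<^sub>C real) set"
  assumes "A \<noteq> {}" and "convex A"
  shows "((some_sup_negative A \<or> some_functional_nonneg_on A) \<and>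
          \<not> (some_sup_negative A \<and> some_functional_nonneg_on A)) \<and>
         (completely_regular_space (euclidean :: 'a topology) \<and>
          Hausdorff_space (euclidean :: 'a topology) \<and>
          pseudocompact_space (euclidean :: 'a topology) \<and>
          bounded A \<and>
          relatively_compactin bcontfun_pointwise_topology A \<longrightarrow>
            (some_sup_negative A \<or>
             some_functional_nonneg_on (bcontfun_pointwise_topology closure_of A)) \<and>
            \<not> (some_sup_negative A \<and>
               some_functional_nonneg_on (bcontfun_pointwise_topology closure_of A)))"
proof -
  have "A \<subseteq> bcontfun_pointwise_topology closure_of A"
    by (rule closure_of_subset) (simp add: bcontfun_pointwise_topology_def topspace_pullback_topology)
  moreover have "some_sup_negative A \<or> some_functional_nonneg_on A"
    using some_functional_nonneg_onI[OF \<open>convex A\<close>]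
    by (force simp: some_sup_negative_def not_less)
  ultimately show ?thesis
    using some_sup_negative_imp_not_nonneg[of A]
      some_functional_nonneg_on_pointwise_closure[OF _ _ _ \<open>convex A\<close>] by blast
qed

end
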